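(* Let $U$ be a monoid, let $M$ be a finite submonoid of $U$, and let $N$ be a submonoid of $M$. Suppose that $x\in M$ and there is $x'\in U$ with $xx'x=x$. If $y\in U$ is arbitrary, then $y\,\mathscr{R}^{M,N}\,x$ if and only if $y\,\mathscr{R}^{U,U}\,x$, $L_y^{U,U}\sim L_x^{U,U}$, and $[x'yv]\in\operatorname{Stab}_N(L_x^{U,U})/\ker(\cdot)$, where $v\in N$ is any element such that $L_y^{U,U}\cdot v=L_x^{U,U}$.
   Context: Submonoids have the same identity as the containing monoid. For a monoid $K$ with submonoid $N$ and $x,y\in K$: $x\,\mathscr{L}^{K,N}\,y$ iff $Nx=Ny$, and $x\,\mathscr{R}^{K,N}\,y$ iff $xN=yN$; the classes of $x$ are $L_x^{K,N}$ and $R_x^{K,N}$. In particular $\mathscr{L}^{U,U},\mathscr{R}^{U,U}$ are the usual Green's relations of $U$. For $y\in U$, "$y\,\mathscr{R}^{M,N}\,x$" means $y\in M$ and $yN=xN$. $N$ acts on the right on subsets of $U$ by $X\cdot n=\{zn:z\in X\}$, and on $\mathscr{L}^{U,U}$-classes by $L_z^{U,U}\cdot n=L_{zn}^{U,U}$. Write $L_x^{U,U}\sim L_y^{U,U}$ if these classes belong to the same strongly connected component of the action of $N$ on $\mathscr{L}^{U,U}$-classes, i.e. there exist $s,t\in N$ with $L_{xs}^{U,U}=L_y^{U,U}$ and $L_{yt}^{U,U}=L_x^{U,U}$ (within a strongly connected component the two actions agree). For $L=L_x^{U,U}$ and a submonoid $K\le U$, $\operatorname{Stab}_K(L)=\{s\in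 K: Ls=L\}$, where $Ls=\{zs:z\in L\}$. $\ker(\cdot)$ is the relation identifying $s,t\in\operatorname{Stab}_U(L)$ when $zs=zt$ for all $z\in L$; $[s]$ denotes the class of $s\in \operatorname{Stab}_U(L)$. $\operatorname{Stab}_N(L)/\ker(\cdot)$ is regarded as a subset of $\operatorname{Stab}_U(L)/\ker(\cdot)$; thus $[x'yv]\in\operatorname{Stab}_N(L)/\ker(\cdot)$ means that $x'yv\in\operatorname{Stab}_U(L)$ and there is $s\in\operatorname{Stab}_N(L)$ with $zs=zx'yv$ for all $z\in L$. *)

theory Defs
  imports "HOL-Algebra.Coset"
begin

text \<open>
  Throughout, \<open>N #>\<^bsub>U\<^esub> x\<close> is the set \<open>Nx\<close> and \<open>x <#\<^bsub>U\<^esub> N\<close> is the set \<open>xN\<close>;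
  the library introduces this notation for cosets, but its definition makes sense for any
  multiplicative structure. \<open>U\<close> is the ambient monoid; \<open>K\<close> and \<open>N\<close> are the
  submonoids of the relations \<open>\<L>\<^sup>K\<^sup>,\<^sup>N\<close> and \<open>\<R>\<^sup>K\<^sup>,\<^sup>N\<close>.
\<close>

definition rel_L :: "('a, 'b) monoid_scheme \<Rightarrow> 'a set \<Rightarrow> 'a set \<Rightarrow> 'a \<Rightarrow> 'a \<Rightarrow> bool" where
  "rel_L U K N x y \<longleftrightarrow> x \<in> K \<and> y \<in> K \<and> N #>\<^bsub>U\<^esub> x = N #>\<^bsub>U\<^esub> y"

definition rel_R :: "('a, 'b) monoid_scheme \<Rightarrow> 'a set \<Rightarrow> 'a set \<Rightarrow> 'a \<Rightarrow> 'a \<Rightarrow> bool" where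
  "rel_R U K N x y \<longleftrightarrow> x \<in> K \<and> y \<in> K \<and> x <#\<^bsub>U\<^esub> N = y <#\<^bsub>U\<^esub> N"

abbreviation green_L :: "('a, 'b) monoid_scheme \<Rightarrow> 'a \<Rightarrow> 'a \<Rightarrow> bool" where
  "green_L U \<equiv> rel_L U (carrier U) (carrier U)"

abbreviation green_R :: "('a, 'b) monoid_scheme \<Rightarrow> 'a \<Rightarrow> 'a \<Rightarrow> bool" where
  "green_R U \<equiv> rel_R U (carrier U) (carrier U)"

definition L_class :: "('a, 'b) monoid_scheme \<Rightarrow> 'a \<Rightarrow> 'a set" where
  "L_class U x = {y. green_L U y x}"

text \<open>
  The action of an element on \<open>\<L>\<^sup>U\<^sup>,\<^sup>U\<close>-classes is \<open>L\<^sub>z \<cdot> n = L\<^sub>z\<^sub>n\<close>. Taking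
  the union over all representatives \<open>z\<close> avoids a choice; by the lemma
  \<open>L_act_L_class\<close> below all members of this union coincide. In general
  \<open>L_act U X n\<close> is larger than the set \<open>X #>\<^bsub>U\<^esub> n\<close>.
\<close>

definition L_act :: "('a, 'b) monoid_scheme \<Rightarrow> 'a set \<Rightarrow> 'a \<Rightarrow> 'a set" where
  "L_act U X n = (\<Union>z\<in>X. L_class U (z \<otimes>\<^bsub>U\<^esub> n))"

lemma (in monoid) L_class_mult_cong:
  assumes "green_L G z z'" "n \<in> carrier G"
  shows "L_class G (z \<otimes> n) = L_class G (z' \<otimes> n)"
proof -
  have z: "z \<in> carrier G" "z' \<in> carrier G" "carrier G #> z = carrier G #> z'"
    using assms(1) by (auto simp: rel_L_def)
  have "carrier G #> (w \<otimes> n) = (\<lambda>u. u \<otimes> n) ` (carrier G #> w)"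
    if "w \<in> carrier G" for w
  proof -
    have "u \<otimes> (w \<otimes> n) = u \<otimes> w \<otimes> n" if "u \<in> carrier G" for u
      using that \<open>w \<in> carrier G\<close> assms(2) by (simp add: m_assoc)
    then show ?thesis
      unfolding r_coset_def by (simp add: image_UN)
  qed
  then have "carrier G #> (z \<otimes> n) = carrier G #> (z' \<otimes> n)"
    using z by simp
  then show ?thesis
    using z assms(2) by (simp add: L_class_def rel_L_def)
qed

lemma (in monoid) L_act_L_class:
  assumes "z \<in> carrier G" "n \<in> carrier G"
  shows "L_act G (L_class G z) n = L_class G (z \<otimes> n)"
proof -
  have "z \<in> L_class G z"
    using assms(1) by (simp add: L_class_def rel_L_def)
  moreover have "L_class G (w \<otimes> n) = L_class G (z \<otimes> n)" if "w \<in> L_class G z" for w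
    using that L_class_mult_cong[OF _ assms(2)] by (simp add: L_class_def)
  ultimately show ?thesis
    unfolding L_act_def by blast
qed

definition same_scc :: "('a, 'b) monoid_scheme \<Rightarrow> 'a set \<Rightarrow> 'a set \<Rightarrow> 'a set \<Rightarrow> bool" where
  "same_scc U N X Y \<longleftrightarrow> (\<exists>s\<in>N. \<exists>t\<in>N. L_act U X s = Y \<and> L_act U Y t = X)"

definition Stab :: "('a, 'b) monoid_scheme \<Rightarrow> 'a set \<Rightarrow> 'a set \<Rightarrow> 'a set" where
  "Stab U K L = {s \<in> K. L #>\<^bsub>U\<^esub> s = L}"

definition stab_ker :: "('a, 'b) monoid_scheme \<Rightarrow> 'a set \<Rightarrow> ('a \<times> 'a) set" where
  "stab_ker U L = {(s, t). s \<in> Stab U (carrier U) L \<and> t \<in> Stab U (carrier U) L \<and>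
     (\<forall>z\<in>L. z \<otimes>\<^bsub>U\<^esub> s = z \<otimes>\<^bsub>U\<^esub> t)}"

text \<open>
  The class \<open>[s]\<close> is \<open>stab_ker U L `` {s}\<close>, which is empty if \<open>s\<close> is not in
  \<open>Stab U (carrier U) L\<close>. The set \<open>Stab U N L // stab_ker U L\<close> consists of the classes
  \<^emph>\<open>in the stabiliser in \<open>U\<close>\<close> of the elements of \<open>Stab U N L\<close>, that is, it is
  \<open>Stab\<^sub>N(L)/ker\<close> regarded as a subset of \<open>Stab\<^sub>U(L)/ker\<close>.
\<close>

lemma stab_class_in_quotient_iff:
  assumes "N \<subseteq> carrier U"
  shows "stab_ker U L `` {r} \<in> Stab U N L // stab_ker U L \<longleftrightarrow>
    r \<in> Stab U (carrier U) L \<and> (\<exists>s\<in>Stab U N L. \<forall>z\<in>L. z \<otimes>\<^bsub>U\<^esub> s = z \<otimes>\<^bsub>U\<^esub> r)"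
    (is "?lhs \<longleftrightarrow> ?rhs")
proof -
  have sub: "s \<in> Stab U (carrier U) L" if "s \<in> Stab U N L" for s
    using that assms unfolding Stab_def by blast
  have "equiv (Stab U (carrier U) L) (stab_ker U L)"
    by (intro equivI refl_onI symI transI) (simp_all add: stab_ker_def subset_iff)
  then have "stab_ker U L `` {r} = stab_ker U L `` {s} \<longleftrightarrow> (r, s) \<in> stab_ker U L"
    if "s \<in> Stab U N L" for s
    using eq_equiv_class[of _ r s] equiv_class_eq sub[OF that] by metis
  then show ?thesis
    using sub unfolding quotient_def stab_ker_def by fastforce
qed

end

theory Submission
  imports Defs
begin

text \<open>
  The condition \<open>[x'yv] \<in> Stab\<^sub>N(L\<^sub>x)/ker\<close> is a disguised form of \<open>yv \<in> xN\<close>. The reason is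
  that \<open>x'\<close> cancels: if \<open>y \<in> xU\<close> then \<open>xx'y = y\<close>, so \<open>x'yv\<close> sends \<open>x\<close> to \<open>yv\<close>, and since
  every element of \<open>L\<^sub>x\<close> is a left multiple of \<open>x\<close>, a right translation of \<open>L\<^sub>x\<close> is determined
  by its value at \<open>x\<close>.

  What remains is to turn one-sided information into two-sided information, and this is where
  finiteness of \<open>M\<close> enters. If \<open>n\<close> has only finitely many powers and \<open>zn\<close> is
  \<open>\<L>\<close>-related to \<open>z\<close>, then some positive power of \<open>n\<close> fixes \<open>z\<close>
  (\<open>power_fixes_of_L_class_eq\<close>). For elements of \<open>N\<close> that map an \<open>\<L>\<close>-class into itself this gives
  an inverse on that class which again lies in \<open>N\<close>. It is used three times:
  to see that an element of \<open>N\<close> that preserves \<open>L\<^sub>x\<close> really stabilises it, with \<open>L\<^sub>xs = L\<^sub>x\<close> as sets;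
  to pass from \<open>xs = yv\<close> with \<open>s\<close> in the stabiliser to \<open>x \<in> yN\<close>; and to pass from
  \<open>L\<^sub>y \<cdot> vt = L\<^sub>y\<close>, which holds for a return path \<open>t\<close> in the strongly connected component, to
  \<open>y \<in> yvN \<subseteq> xN\<close>. In particular \<open>y\<close> lies in \<open>M\<close>.
\<close>

section \<open>Green's relations as mutual divisibility\<close>

lemma (in monoid) rel_R_iff_mutual_multiples:
  assumes "submonoid N G" and "K \<subseteq> carrier G"
  shows "rel_R G K N y z \<longleftrightarrow>
    y \<in> K \<and> z \<in> K \<and> (\<exists>a\<in>N. y = z \<otimes> a) \<and> (\<exists>b\<in>N. z = y \<otimes> b)"
proof -
  interpret N: submonoid N G by fact
  have sub: "y <# N \<subseteq> z <# N \<longleftrightarrow> (\<exists>a\<in>N. y = z \<otimes> a)"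
    if "y \<in> carrier G" "z \<in> carrier G" for y z
  proof
    assume "y <# N \<subseteq> z <# N"
    moreover have "y \<in> y <# N"
      using that(1) N.one_closed unfolding l_coset_def by (metis UN_iff insertI1 r_one)
    ultimately show "\<exists>a\<in>N. y = z \<otimes> a"
      by (auto simp: l_coset_def)
  next
    assume "\<exists>a\<in>N. y = z \<otimes> a"
    then obtain a where "a \<in> N" "y = z \<otimes> a" by blast
    then have "y \<otimes> n = z \<otimes> (a \<otimes> n)" if "n \<in> N" for n
      using that \<open>z \<in> carrier G\<close> by (simp add: m_assoc)
    then show "y <# N \<subseteq> z <# N"
      using \<open>a \<in> N\<close> by (auto simp: l_coset_def)
  qed
  show ?thesis
    using sub[of y z] sub[of z y] subsetD[OF assms(2), of y] subsetD[OF assms(2), of z]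
    unfolding rel_R_def set_eq_subset by argo
qed

lemma (in monoid) green_L_iff_mutual_multiples:
  "green_L G y z \<longleftrightarrow> y \<in> carrier G \<and> z \<in> carrier G \<and>
    (\<exists>u\<in>carrier G. y = u \<otimes> z) \<and> (\<exists>u\<in>carrier G. z = u \<otimes> y)"
proof -
  have sub: "carrier G #> y \<subseteq> carrier G #> z \<longleftrightarrow> (\<exists>u\<in>carrier G. y = u \<otimes> z)"
    if "y \<in> carrier G" "z \<in> carrier G" for y z
  proof
    assume "carrier G #> y \<subseteq> carrier G #> z"
    moreover have "y \<in> carrier G #> y"
      using that(1) one_closed unfolding r_coset_def by (metis UN_iff insertI1 l_one)
    ultimately show "\<exists>u\<in>carrier G. y = u \<otimes> z"
      by (auto simp: r_coset_def)
  next
    assume "\<exists>u\<in>carrier G. y = u \<otimes> z"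
    then obtain u where "u \<in> carrier G" "y = u \<otimes> z" by blast
    then have "w \<otimes> y = (w \<otimes> u) \<otimes> z" if "w \<in> carrier G" for w
      using that \<open>z \<in> carrier G\<close> by (simp add: m_assoc)
    then show "carrier G #> y \<subseteq> carrier G #> z"
      using \<open>u \<in> carrier G\<close> by (auto simp: r_coset_def)
  qed
  show ?thesis
    using sub[of y z] sub[of z y] unfolding rel_L_def set_eq_subset by auto
qed

lemma (in monoid) L_class_eq_iff:
  assumes "y \<in> carrier G" "z \<in> carrier G"
  shows "L_class G y = L_class G z \<longleftrightarrow> green_L G y z"
  using assms by (auto simp: L_class_def rel_L_def)

lemma (in monoid) mem_L_class_iff:
  assumes "x \<in> carrier G"
  shows "z \<in> L_class G x \<longleftrightarrow> z \<in> carrier G \<and> L_class G z = L_class G x"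
  using assms by (auto simp: L_class_def rel_L_def)

lemma (in monoid) L_classE:
  assumes "z \<in> L_class G x"
  obtains u where "u \<in> carrier G" "z = u \<otimes> x"
  using assms that unfolding L_class_def green_L_iff_mutual_multiples by blast

section \<open>Elements with finitely many powers\<close>

lemma (in monoid) finite_powers_of_mem_finite_submonoid:
  assumes "submonoid M G" "finite M" "n \<in> M"
  shows "finite (range (\<lambda>i::nat. n [^] i))"
proof -
  interpret M: submonoid M G by fact
  have "n [^] i \<in> M" for i :: nat
    using assms(3) by (induction i) auto
  then show ?thesis
    using assms(2) by (blast intro: finite_subset)
qed

text \<open>
  Some power of \<open>n\<close> repeats, say \<open>n\<^sup>i = n\<^sup>i\<^sup>+\<^sup>j\<close> with \<open>j > 0\<close>. From \<open>z = wzn\<close>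
  follows \<open>z = w\<^sup>izn\<^sup>i\<close>, which supplies the factor \<open>n\<^sup>i\<close> on which the repetition acts:
  \<open>zn\<^sup>j = w\<^sup>izn\<^sup>i\<^sup>+\<^sup>j = w\<^sup>izn\<^sup>i = z\<close>.
  The exponent is written \<open>Suc k\<close> to record that it is positive.
\<close>

lemma (in monoid) power_fixes_of_L_class_eq:
  assumes z: "z \<in> carrier G" and n: "n \<in> carrier G"
    and fin: "finite (range (\<lambda>i::nat. n [^] i))"
    and eq: "L_class G (z \<otimes> n) = L_class G z"
  obtains k :: nat where "z \<otimes> n [^] Suc k = z"
proof -
  obtain w where w: "w \<in> carrier G" "w \<otimes> (z \<otimes> n) = z"
    using eq z n unfolding L_class_eq_iff[OF m_closed[OF z n] z] green_L_iff_mutual_multiples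
    by metis
  have pow_comm: "n [^] i \<otimes> n = n \<otimes> n [^] i" for i :: nat
    using nat_pow_Suc2[OF n, of i] by simp
  have iter: "w [^] i \<otimes> (z \<otimes> n [^] i) = z" for i :: nat
  proof (induction i)
    case 0
    show ?case using z by simp
  next
    case (Suc i)
    have "w [^] Suc i \<otimes> (z \<otimes> n [^] Suc i)
        = w [^] i \<otimes> ((w \<otimes> (z \<otimes> n)) \<otimes> n [^] i)"
      using w(1) z n
      by (simp add: pow_comm m_assoc)
    also have "\<dots> = z"
      using Suc.IH w(2) by simp
    finally show ?case by simp
  qed
  have "\<not> inj (\<lambda>i::nat. n [^] i)"
    using fin finite_imageD[of "\<lambda>i::nat. n [^] i" UNIV] infinite_UNIV_nat by blast
  then obtain i j :: nat where "i < j" "n [^] i = n [^] j"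
    unfolding inj_def by (metis linorder_neqE_nat)
  then obtain k where k: "n [^] (i + Suc k) = n [^] i"
    by (metis less_imp_Suc_add add_Suc_right)
  have "z \<otimes> n [^] Suc k = (w [^] i \<otimes> (z \<otimes> n [^] i)) \<otimes> n [^] Suc k"
    using iter[of i] by simp
  also have "\<dots> = w [^] i \<otimes> (z \<otimes> n [^] (i + Suc k))"
    using w(1) z n nat_pow_mult[OF n, of i "Suc k"] by (simp add: m_assoc)
  also have "\<dots> = z"
    using k iter[of i] by simp
  finally show ?thesis by (rule that)
qed

text \<open>
  By finiteness an element of \<open>N\<close> that keeps the class of \<open>z\<close> can be undone at \<open>z\<close> by
  an element of the same submonoid, namely the complementary power.
\<close>

lemma (in monoid) mult_cancelled_in_submonoid:
  assumes "submonoid N G" and "n \<in> N" and z: "z \<in> carrier G"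
    and fin: "finite (range (\<lambda>i::nat. n [^] i))"
    and eq: "L_class G (z \<otimes> n) = L_class G z"
  obtains m where "m \<in> N" "z \<otimes> n \<otimes> m = z"
proof -
  interpret N: submonoid N G by fact
  have n: "n \<in> carrier G" using assms(2) by simp
  obtain k :: nat where k: "z \<otimes> n [^] Suc k = z"
    using power_fixes_of_L_class_eq[OF z n fin eq] by blast
  have "n [^] i \<in> N" for i :: nat
    using assms(2) by (induction i) auto
  moreover have "z \<otimes> n \<otimes> n [^] k = z"
    using k nat_pow_Suc2[OF n, of k] z n by (simp add: m_assoc)
  ultimately show ?thesis using that by blast
qed

section \<open>Stabilisers of an \<L>-class\<close>

text \<open>
  The inclusion \<open>L\<^sub>xn \<subseteq> L\<^sub>x\<close> holds because \<open>\<L>\<close> is a right congruence. For the converse, a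
  power \<open>n\<^sup>k\<^sup>+\<^sup>1\<close> that fixes \<open>x\<close> fixes every \<open>z = ux\<close>, so \<open>zn\<^sup>k\<close> is a preimage of \<open>z\<close>.
\<close>

lemma (in monoid) mem_Stab_of_L_class_eq:
  assumes x: "x \<in> carrier G" and n: "n \<in> carrier G" and "n \<in> K"
    and fin: "finite (range (\<lambda>i::nat. n [^] i))"
    and eq: "L_class G (x \<otimes> n) = L_class G x"
  shows "n \<in> Stab G K (L_class G x)"
proof -
  let ?L = "L_class G x"
  have into: "z \<otimes> n \<in> ?L" if "z \<in> ?L" for z
  proof -
    have "green_L G z x" using that by (simp add: L_class_def)
    then have "L_class G (z \<otimes> n) = ?L"
      using L_class_mult_cong n eq by blast
    then show ?thesis
      using that n x by (simp add: mem_L_class_iff)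
  qed
  have into_pow: "z \<otimes> n [^] i \<in> ?L" if "z \<in> ?L" for z and i :: nat
  proof (induction i)
    case 0
    show ?case using that x by (simp add: mem_L_class_iff)
  next
    case (Suc i)
    have "z \<in> carrier G" using that x by (simp add: mem_L_class_iff)
    then show ?case using into[OF Suc.IH] n by (simp add: m_assoc)
  qed
  obtain k :: nat where k: "x \<otimes> n [^] Suc k = x"
    using power_fixes_of_L_class_eq[OF x n fin eq] by blast
  have "\<exists>z'\<in>?L. z = z' \<otimes> n" if z: "z \<in> ?L" for z
  proof -
    obtain u where u: "u \<in> carrier G" "z = u \<otimes> x"
      using z by (rule L_classE)
    have "(z \<otimes> n [^] k) \<otimes> n = u \<otimes> (x \<otimes> n [^] Suc k)"
      using u x n by (simp add: m_assoc)
    also have "\<dots> = z" using k u by simp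
    finally show ?thesis using into_pow[OF z] by metis
  qed
  then have "?L #> n = ?L"
    using into by (auto simp: r_coset_def)
  then show ?thesis using \<open>n \<in> K\<close> by (simp add: Stab_def)
qed

lemma (in monoid) L_class_mult_Stab:
  assumes "x \<in> carrier G" "s \<in> Stab G K (L_class G x)"
  shows "L_class G (x \<otimes> s) = L_class G x"
proof -
  have "x \<otimes> s \<in> L_class G x #> s"
    using assms(1) by (auto simp: r_coset_def mem_L_class_iff)
  then show ?thesis
    using assms by (simp add: Stab_def mem_L_class_iff)
qed

lemma mem_Stab_cong:
  assumes "s \<in> Stab U K L" "r \<in> K'" "\<And>z. z \<in> L \<Longrightarrow> z \<otimes>\<^bsub>U\<^esub> s = z \<otimes>\<^bsub>U\<^esub> r"
  shows "r \<in> Stab U K' L"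
  using assms by (simp add: Stab_def r_coset_def)

section \<open>Relative \<R>-classes of a regular element\<close>

lemma (in monoid) regular_left_unit:
  assumes "x \<in> carrier G" "x' \<in> carrier G" "a \<in> carrier G" "x \<otimes> x' \<otimes> x = x" "y = x \<otimes> a"
  shows "x \<otimes> x' \<otimes> y = y"
  using assms by (metis m_assoc m_closed)

text \<open>
  If \<open>y = xa\<close> with \<open>a \<in> N\<close>, then \<open>x'yv\<close> acts on \<open>L\<^sub>x\<close> as the element \<open>av\<close> of \<open>N\<close> does, because both
  send \<open>x\<close> to \<open>yv\<close>.
\<close>

lemma (in monoid) stab_class_of_right_multiple:
  assumes N: "submonoid N G" and fin: "\<And>n. n \<in> N \<Longrightarrow> finite (range (\<lambda>i::nat. n [^] i))"
    and x: "x \<in> carrier G" and x': "x' \<in> carrier G" and reg: "x \<otimes> x' \<otimes> x = x"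
    and a: "a \<in> N" and y: "y = x \<otimes> a" and v: "v \<in> N"
    and eq: "L_class G (y \<otimes> v) = L_class G x"
  shows "stab_ker G (L_class G x) `` {x' \<otimes> y \<otimes> v}
    \<in> Stab G N (L_class G x) // stab_ker G (L_class G x)"
proof -
  interpret N: submonoid N G by fact
  have car: "a \<in> carrier G" "v \<in> carrier G" "y \<in> carrier G"
    using a v x y by auto
  have av: "a \<otimes> v \<in> Stab G N (L_class G x)"
    using mem_Stab_of_L_class_eq[OF x _ _ fin, of "a \<otimes> v" N] a v x car eq y
    by (simp add: m_assoc)
  have act: "z \<otimes> (a \<otimes> v) = z \<otimes> (x' \<otimes> y \<otimes> v)" if "z \<in> L_class G x" for z
  proof -
    obtain u where u: "u \<in> carrier G" "z = u \<otimes> x"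
      using \<open>z \<in> L_class G x\<close> by (rule L_classE)
    have "z \<otimes> (x' \<otimes> y \<otimes> v) = u \<otimes> ((x \<otimes> x' \<otimes> y) \<otimes> v)"
      using u x x' car by (simp add: m_assoc)
    also have "\<dots> = u \<otimes> ((x \<otimes> a) \<otimes> v)"
      using regular_left_unit[OF x x' car(1) reg y] y by simp
    also have "\<dots> = z \<otimes> (a \<otimes> v)"
      using u x car by (simp add: m_assoc)
    finally show ?thesis by simp
  qed
  have "x' \<otimes> y \<otimes> v \<in> Stab G (carrier G) (L_class G x)"
    using mem_Stab_cong[OF av _ act] x' car by simp
  then show ?thesis
    using av act by (subst stab_class_in_quotient_iff) (auto simp: N.subset)
qed

text \<open>
  Evaluating the stabiliser condition at \<open>x\<close> gives \<open>xs = yv\<close> with \<open>s \<in> N\<close>. Undoing \<open>s\<close> at \<open>x\<close>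
  puts \<open>x\<close> into \<open>yN\<close>; undoing \<open>vt\<close> at \<open>y\<close>, where \<open>t\<close> leads from the class of \<open>x\<close> back to
  that of \<open>y\<close>, puts \<open>y\<close> into \<open>yvN = xsN\<close>.
\<close>

lemma (in monoid) right_multiples_of_stab_class:
  assumes N: "submonoid N G" and fin: "\<And>n. n \<in> N \<Longrightarrow> finite (range (\<lambda>i::nat. n [^] i))"
    and x: "x \<in> carrier G" and x': "x' \<in> carrier G" and reg: "x \<otimes> x' \<otimes> x = x"
    and R: "green_R G y x" and v: "v \<in> N" and t: "t \<in> N"
    and Lv: "L_class G (y \<otimes> v) = L_class G x" and Lt: "L_class G (x \<otimes> t) = L_class G y"
    and stab: "stab_ker G (L_class G x) `` {x' \<otimes> y \<otimes> v}
      \<in> Stab G N (L_class G x) // stab_ker G (L_class G x)"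
  shows "(\<exists>a\<in>N. y = x \<otimes> a) \<and> (\<exists>b\<in>N. x = y \<otimes> b)"
proof -
  interpret N: submonoid N G by fact
  have G: "submonoid (carrier G) G" by unfold_locales auto
  obtain c where y: "y \<in> carrier G" and c: "c \<in> carrier G" "y = x \<otimes> c"
    using R by (auto simp: rel_R_iff_mutual_multiples[OF G])
  have car: "v \<in> carrier G" "t \<in> carrier G" using v t by auto
  obtain s where s: "s \<in> Stab G N (L_class G x)"
    and act: "\<And>z. z \<in> L_class G x \<Longrightarrow> z \<otimes> s = z \<otimes> (x' \<otimes> y \<otimes> v)"
    using stab by (subst (asm) stab_class_in_quotient_iff) (auto simp: N.subset)
  have sN: "s \<in> N" using s by (simp add: Stab_def)
  have scar: "s \<in> carrier G" using sN by simp
  have "x \<otimes> s = x \<otimes> (x' \<otimes> y \<otimes> v)"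
    using act x by (simp add: mem_L_class_iff)
  also have "\<dots> = (x \<otimes> x' \<otimes> y) \<otimes> v"
    using x x' y car by (simp add: m_assoc)
  also have "\<dots> = y \<otimes> v"
    using regular_left_unit[OF x x' c(1) reg c(2)] by simp
  finally have xs: "x \<otimes> s = y \<otimes> v" .
  obtain m where m: "m \<in> N" "x \<otimes> s \<otimes> m = x"
    using mult_cancelled_in_submonoid[OF N sN x fin[OF sN] L_class_mult_Stab[OF x s]] by blast
  have "x = y \<otimes> (v \<otimes> m)"
    using xs m y car by (simp add: m_assoc)
  moreover have "v \<otimes> m \<in> N" using v m by simp
  ultimately have b: "\<exists>b\<in>N. x = y \<otimes> b" by blast
  have vt: "v \<otimes> t \<in> N" using v t by simp
  have "L_class G (y \<otimes> (v \<otimes> t)) = L_class G (x \<otimes> t)"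
    using L_class_mult_cong[of "y \<otimes> v" x t] Lv x y car
    by (simp add: L_class_eq_iff m_assoc)
  then have Lvt: "L_class G (y \<otimes> (v \<otimes> t)) = L_class G y" using Lt by simp
  obtain m' where m': "m' \<in> N" "y \<otimes> (v \<otimes> t) \<otimes> m' = y"
    using mult_cancelled_in_submonoid[OF N vt y fin[OF vt] Lvt] by blast
  have "y = (y \<otimes> v) \<otimes> (t \<otimes> m')"
    using m' y car by (simp add: m_assoc)
  also have "\<dots> = x \<otimes> (s \<otimes> (t \<otimes> m'))"
    unfolding xs[symmetric] using x scar car m' by (simp add: m_assoc)
  finally have "y = x \<otimes> (s \<otimes> (t \<otimes> m'))" .
  moreover have "s \<otimes> (t \<otimes> m') \<in> N" using sN t m' by simp
  ultimately show ?thesis using b by blast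
qed

theorem proposition7p8:
  fixes U :: "('a, 'b) monoid_scheme"
    and M N :: "'a set"
    and x x' y :: 'a
  assumes "monoid U"
    and "submonoid M U" and "finite M"
    and "submonoid N (U\<lparr>carrier := M\<rparr>)"
    and "x \<in> M"
    and "x' \<in> carrier U" and "x \<otimes>\<^bsub>U\<^esub> x' \<otimes>\<^bsub>U\<^esub> x = x"
    and "y \<in> carrier U"
  shows "(rel_R U M N y x \<longleftrightarrow>
            green_R U y x \<and>
            same_scc U N (L_class U y) (L_class U x) \<and>
            (\<forall>v\<in>N. L_act U (L_class U y) v = L_class U x \<longrightarrow>
               stab_ker U (L_class U x) `` {x' \<otimes>\<^bsub>U\<^esub> y \<otimes>\<^bsub>U\<^esub> v}
                 \<in> Stab U N (L_class U x) // stab_ker U (L_class U x)))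
       \<and> (rel_R U M N y x \<longleftrightarrow>
            green_R U y x \<and>
            same_scc U N (L_class U y) (L_class U x) \<and>
            (\<exists>v\<in>N. L_act U (L_class U y) v = L_class U x \<and>
               stab_ker U (L_class U x) `` {x' \<otimes>\<^bsub>U\<^esub> y \<otimes>\<^bsub>U\<^esub> v}
                 \<in> Stab U N (L_class U x) // stab_ker U (L_class U x)))"
    (is "(?R \<longleftrightarrow> ?G \<and> ?S \<and> (\<forall>v\<in>N. ?P v \<longrightarrow> ?Q v)) \<and> (_ \<longleftrightarrow> _ \<and> _ \<and> (\<exists>v\<in>N. ?P v \<and> ?Q v))")
proof -
  interpret monoid U by fact
  interpret M: submonoid M U by fact
  have NM: "N \<subseteq> M"
    using submonoid.subset[OF assms(4)] by simp
  have N: "submonoid N U"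
    using submonoid.m_closed[OF assms(4)] submonoid.one_closed[OF assms(4)] NM M.subset
    by unfold_locales auto
  interpret N: submonoid N U by fact
  have Ucar: "submonoid (carrier U) U" by unfold_locales auto
  have x: "x \<in> carrier U" using assms(5) by simp
  note x' = assms(6) and reg = assms(7) and y = assms(8)
  have fin: "finite (range (\<lambda>i::nat. n [^]\<^bsub>U\<^esub> i))" if "n \<in> N" for n
    using finite_powers_of_mem_finite_submonoid[OF assms(2,3)] that NM by blast
  have act_y: "?P v \<longleftrightarrow> L_class U (y \<otimes>\<^bsub>U\<^esub> v) = L_class U x" if "v \<in> N" for v
    using that y by (simp add: L_act_L_class)
  have act_x: "L_act U (L_class U x) t = L_class U y \<longleftrightarrow>
      L_class U (x \<otimes>\<^bsub>U\<^esub> t) = L_class U y" if "t \<in> N" for t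
    using that x by (simp add: L_act_L_class)
  have R_iff: "?R \<longleftrightarrow> y \<in> M \<and> x \<in> M \<and> (\<exists>a\<in>N. y = x \<otimes>\<^bsub>U\<^esub> a) \<and> (\<exists>b\<in>N. x = y \<otimes>\<^bsub>U\<^esub> b)"
    by (rule rel_R_iff_mutual_multiples[OF N M.subset])
  have forward: "?G \<and> ?S \<and> (\<forall>v\<in>N. ?P v \<longrightarrow> ?Q v)" if R: ?R
  proof (intro conjI ballI impI)
    obtain a b where a: "a \<in> N" "y = x \<otimes>\<^bsub>U\<^esub> a" and b: "b \<in> N" "x = y \<otimes>\<^bsub>U\<^esub> b"
      using R R_iff by blast
    show ?G
      using a b x y N.subset by (auto simp: rel_R_iff_mutual_multiples[OF Ucar])
    show ?S
      unfolding same_scc_def using a b act_x act_y by metis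
    show "?Q v" if "v \<in> N" "?P v" for v
      using stab_class_of_right_multiple[OF N fin x x' reg a \<open>v \<in> N\<close>] act_y that by blast
  qed
  have backward: ?R if ?G ?S "v \<in> N" "?P v" "?Q v" for v
  proof -
    obtain t where t: "t \<in> N" "L_class U (x \<otimes>\<^bsub>U\<^esub> t) = L_class U y"
      using \<open>?S\<close> act_x unfolding same_scc_def by blast
    have "(\<exists>a\<in>N. y = x \<otimes>\<^bsub>U\<^esub> a) \<and> (\<exists>b\<in>N. x = y \<otimes>\<^bsub>U\<^esub> b)"
      using right_multiples_of_stab_class[OF N fin x x' reg \<open>?G\<close> \<open>v \<in> N\<close> t(1) _ t(2) \<open>?Q v\<close>]
        act_y[OF \<open>v \<in> N\<close>] \<open>?P v\<close> by blast
    moreover from this have "y \<in> M"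
      using assms(5) NM by auto
    ultimately show ?R
      using R_iff assms(5) by blast
  qed
  \<comment> \<open>Strong connectedness supplies an admissible \<open>v\<close>, so that the universal form of the
      stabiliser condition implies the existential one.\<close>
  have "\<exists>v\<in>N. ?P v" if ?S
    using that unfolding same_scc_def by blast
  then show ?thesis
    using forward backward by blast
qed

end
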